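(* Let $K$ be an infinite field, let $\alpha\in K$ with $\alpha\neq 0$, and let $L_2$ be the three-dimensional Leibniz algebra over $K$ with basis $\{e_1,e_2,e_3\}$ and nonzero products of basis elements $e_1e_3=\alpha e_1$, $e_3e_2=e_2$, $e_2e_3=-e_2$. Then the polynomials $(x_1x_2)(x_3x_4)$ and \[ s_3(x_1,x_2,x_3)=x_1x_2x_3-x_1x_3x_2-x_2x_1x_3+x_2x_3x_1+x_3x_1x_2-x_3x_2x_1 \] generate the ideal of identities of $L_2$ as a $T$-ideal.
   Context: A (right) Leibniz algebra over $K$ is a $K$-algebra satisfying $x(yz)=(xy)z-(xz)y$. Identities live in the free Leibniz algebra $\mathcal L\langle X\rangle$ over $K$ on $X=\{x_1,x_2,\dots\}$; the ideal of identities of $L$ is the set of polynomials vanishing under all substitutions of elements of $L$. A $T$-ideal is an ideal invariant under all endomorphisms of $\mathcal L\langle X\rangle$, and it is generated by $S$ if it is the smallest $T$-ideal containing $S$. Products without brackets are left-normed. Products of basis elements not listed are zero. *)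

theory Defs
  imports "HOL-Analysis.Cartesian_Space" "HOL-Library.Poly_Mapping"
begin

section \<open>Nonassociative algebras over a field\<close>

text \<open>
  An algebra is a vector space (given by its scalar multiplication) with a bilinear product;
  neither associativity nor a unit is assumed.
\<close>

locale nonassoc_algebra = vector_space scale
  for scale :: "'k::field \<Rightarrow> 'v::ab_group_add \<Rightarrow> 'v" +
  fixes mult :: "'v \<Rightarrow> 'v \<Rightarrow> 'v"
  assumes mult_add_left: "mult (x + y) z = mult x z + mult y z"
    and mult_add_right: "mult x (y + z) = mult x y + mult x z"
    and mult_scale_left: "mult (scale c x) y = scale c (mult x y)"
    and mult_scale_right: "mult x (scale c y) = scale c (mult x y)"
begin

lemma linear_mult_left: "Vector_Spaces.linear scale scale (\<lambda>x. mult x y)"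
  by unfold_locales (auto simp: algebra_simps mult_add_left mult_scale_left)

lemma linear_mult_right: "Vector_Spaces.linear scale scale (\<lambda>y. mult x y)"
  by unfold_locales (auto simp: algebra_simps mult_add_right mult_scale_right)

lemma mult_diff_left: "mult (x - y) z = mult x z - mult y z"
  using module_hom.diff[OF Vector_Spaces.linear.axioms(3)[OF linear_mult_left]] .

lemma mult_diff_right: "mult x (y - z) = mult x y - mult x z"
  using module_hom.diff[OF Vector_Spaces.linear.axioms(3)[OF linear_mult_right]] .

end

locale leibniz_algebra = nonassoc_algebra scale mult
  for scale :: "'k::field \<Rightarrow> 'v::ab_group_add \<Rightarrow> 'v" and mult :: "'v \<Rightarrow> 'v \<Rightarrow> 'v" +
  assumes leibniz: "mult x (mult y z) = mult (mult x y) z - mult (mult x z) y"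

definition alg_ideal ::
    "('k::field \<Rightarrow> 'v::ab_group_add \<Rightarrow> 'v) \<Rightarrow> ('v \<Rightarrow> 'v \<Rightarrow> 'v) \<Rightarrow> 'v set \<Rightarrow> bool"
  where "alg_ideal s m I \<longleftrightarrow>
    module.subspace s I \<and> (\<forall>f\<in>I. \<forall>g. m f g \<in> I \<and> m g f \<in> I)"

definition alg_hom ::
    "('k::field \<Rightarrow> 'v::ab_group_add \<Rightarrow> 'v) \<Rightarrow> ('v \<Rightarrow> 'v \<Rightarrow> 'v) \<Rightarrow>
     ('k \<Rightarrow> 'w::ab_group_add \<Rightarrow> 'w) \<Rightarrow> ('w \<Rightarrow> 'w \<Rightarrow> 'w) \<Rightarrow> ('v \<Rightarrow> 'w) \<Rightarrow> bool"
  where "alg_hom s1 m1 s2 m2 \<phi> \<longleftrightarrow>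
    Vector_Spaces.linear s1 s2 \<phi> \<and> (\<forall>f g. \<phi> (m1 f g) = m2 (\<phi> f) (\<phi> g))"

lemma (in nonassoc_algebra) alg_ideal_Inter:
  assumes "\<forall>I\<in>\<I>. alg_ideal scale mult I"
  shows "alg_ideal scale mult (\<Inter>\<I>)"
  using assms by (simp add: alg_ideal_def subspace_Inter)

lemma (in nonassoc_algebra) alg_ideal_hull: "alg_ideal scale mult (alg_ideal scale mult hull S)"
  by (rule hull_in) (rule alg_ideal_Inter)


section \<open>The free nonassociative algebra\<close>

text \<open>Bracketed words in the letters \<open>Var 0, Var 1, \<dots>\<close>, and their finite linear combinations.\<close>

datatype bword = Var nat | Br bword bword

definition lin_ext :: "('k::field \<Rightarrow> 'v::ab_group_add \<Rightarrow> 'v) \<Rightarrow> ('b \<Rightarrow> 'v) \<Rightarrow> ('b \<Rightarrow>\<^sub>0 'k) \<Rightarrow> 'v"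
  where "lin_ext s f p = (\<Sum>w\<in>Poly_Mapping.keys p. s (Poly_Mapping.lookup p w) (f w))"

definition na_scale :: "'k::field \<Rightarrow> (bword \<Rightarrow>\<^sub>0 'k) \<Rightarrow> (bword \<Rightarrow>\<^sub>0 'k)"
  where "na_scale c p = Poly_Mapping.map ((*) c) p"

definition na_mult :: "(bword \<Rightarrow>\<^sub>0 'k::field) \<Rightarrow> (bword \<Rightarrow>\<^sub>0 'k) \<Rightarrow> (bword \<Rightarrow>\<^sub>0 'k)"
  where "na_mult p q =
    lin_ext na_scale (\<lambda>u. lin_ext na_scale (\<lambda>v. Poly_Mapping.single (Br u v) 1) q) p"

fun eval_word :: "('v \<Rightarrow> 'v \<Rightarrow> 'v) \<Rightarrow> (nat \<Rightarrow> 'v) \<Rightarrow> bword \<Rightarrow> 'v" where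
  "eval_word mult a (Var i) = a i"
| "eval_word mult a (Br u v) = mult (eval_word mult a u) (eval_word mult a v)"

definition na_eval ::
    "('k::field \<Rightarrow> 'v::ab_group_add \<Rightarrow> 'v) \<Rightarrow> ('v \<Rightarrow> 'v \<Rightarrow> 'v) \<Rightarrow> (nat \<Rightarrow> 'v) \<Rightarrow> (bword \<Rightarrow>\<^sub>0 'k) \<Rightarrow> 'v"
  where "na_eval s m a = lin_ext s (eval_word m a)"

lemma lookup_na_scale [simp]: "Poly_Mapping.lookup (na_scale c p) w = c * Poly_Mapping.lookup p w"
  by (simp add: na_scale_def map.rep_eq when_def)

lemma vector_space_na_scale: "vector_space (na_scale :: 'k::field \<Rightarrow> _)"
  by unfold_locales (auto intro!: poly_mapping_eqI simp: lookup_add algebra_simps)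

lemma (in vector_space) lin_ext_superset:
  assumes "finite A" "Poly_Mapping.keys p \<subseteq> A"
  shows "lin_ext scale f p = (\<Sum>w\<in>A. scale (Poly_Mapping.lookup p w) (f w))"
  unfolding lin_ext_def using assms
  by (intro sum.mono_neutral_left) (auto simp: in_keys_iff)

lemma (in vector_space) linear_lin_ext: "Vector_Spaces.linear na_scale scale (lin_ext scale f)"
proof -
  interpret na: vector_space na_scale by (rule vector_space_na_scale)
  have add: "lin_ext scale f (p + q) = lin_ext scale f p + lin_ext scale f q" for p q
  proof -
    let ?A = "Poly_Mapping.keys p \<union> Poly_Mapping.keys q"
    have "lin_ext scale f (p + q) = (\<Sum>w\<in>?A. scale (Poly_Mapping.lookup (p + q) w) (f w))"
      by (rule lin_ext_superset) (use keys_add[of p q] in auto)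
    also have "\<dots> = (\<Sum>w\<in>?A. scale (Poly_Mapping.lookup p w) (f w)) + (\<Sum>w\<in>?A. scale (Poly_Mapping.lookup q w) (f w))"
      by (simp add: lookup_add scale_left_distrib sum.distrib)
    also have "\<dots> = lin_ext scale f p + lin_ext scale f q"
      using lin_ext_superset[of ?A p f] lin_ext_superset[of ?A q f] by simp
    finally show ?thesis .
  qed
  have scl: "lin_ext scale f (na_scale c p) = scale c (lin_ext scale f p)" for c p
  proof -
    have "lin_ext scale f (na_scale c p) = (\<Sum>w\<in>Poly_Mapping.keys p. scale (Poly_Mapping.lookup (na_scale c p) w) (f w))"
      by (rule lin_ext_superset) (auto simp: in_keys_iff)
    then show ?thesis by (simp add: lin_ext_def scale_sum_right)
  qed
  show ?thesis by unfold_locales (auto simp: add scl)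
qed

lemma (in vector_space) lin_ext_single [simp]: "lin_ext scale f (Poly_Mapping.single w 1) = f w"
  by (simp add: lin_ext_def)

lemma linear_comp_lin_ext:
  assumes "Vector_Spaces.linear s1 s2 \<phi>"
  shows "\<phi> (lin_ext s1 f p) = lin_ext s2 (\<lambda>w. \<phi> (f w)) p"
proof -
  interpret l: Vector_Spaces.linear s1 s2 \<phi> by (rule assms)
  show ?thesis by (simp add: lin_ext_def l.sum l.scale)
qed

lemma lin_ext_na_single [simp]: "lin_ext na_scale (\<lambda>w. Poly_Mapping.single w 1) p = p"
proof (rule poly_mapping_eqI)
  fix u
  show "Poly_Mapping.lookup (lin_ext na_scale (\<lambda>w. Poly_Mapping.single w 1) p) u = Poly_Mapping.lookup p u"
    by (auto simp: lin_ext_def lookup_sum lookup_single when_def if_distrib[of "(*) _"] in_keys_iff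
        cong: if_cong)
qed

lemma (in vector_space) lin_ext_fun_add:
  "lin_ext scale (\<lambda>w. f w + g w) p = lin_ext scale f p + lin_ext scale g p"
  by (simp add: lin_ext_def scale_right_distrib sum.distrib)

lemma (in vector_space) lin_ext_fun_scale:
  "lin_ext scale (\<lambda>w. scale c (f w)) p = scale c (lin_ext scale f p)"
  by (simp add: lin_ext_def scale_sum_right mult.commute)

lemma na_algebra: "nonassoc_algebra (na_scale :: 'k::field \<Rightarrow> _) na_mult"
proof -
  interpret na: vector_space "na_scale :: 'k \<Rightarrow> _" by (rule vector_space_na_scale)
  have *: "module_hom na_scale na_scale (lin_ext na_scale f)" for f :: "bword \<Rightarrow> (bword \<Rightarrow>\<^sub>0 'k)"
    by (rule Vector_Spaces.linear.axioms(3)[OF na.linear_lin_ext])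
  show ?thesis
    by unfold_locales
      (simp_all add: na_mult_def module_hom.add[OF *] module_hom.scale[OF *]
        na.lin_ext_fun_add na.lin_ext_fun_scale)
qed

lemma na_mult_single:
  "na_mult (Poly_Mapping.single u 1) (Poly_Mapping.single v 1) =
    (Poly_Mapping.single (Br u v) 1 :: bword \<Rightarrow>\<^sub>0 'k::field)"
  by (simp add: na_mult_def vector_space.lin_ext_single[OF vector_space_na_scale])

lemma (in nonassoc_algebra) na_eval_hom:
  "alg_hom na_scale na_mult scale mult (na_eval scale mult a)"
proof -
  have lin: "Vector_Spaces.linear na_scale scale (na_eval scale mult a)"
    unfolding na_eval_def by (rule linear_lin_ext)
  have "na_eval scale mult a (na_mult p q) = mult (na_eval scale mult a p) (na_eval scale mult a q)"
    for p q
  proof -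
    have "na_eval scale mult a (na_mult p q) =
      lin_ext scale (\<lambda>u. lin_ext scale (\<lambda>v. mult (eval_word mult a u) (eval_word mult a v)) q) p"
      unfolding na_mult_def linear_comp_lin_ext[OF lin] by (simp add: na_eval_def)
    also have "\<dots> = lin_ext scale (\<lambda>u. mult (eval_word mult a u) (na_eval scale mult a q)) p"
      unfolding na_eval_def linear_comp_lin_ext[OF linear_mult_right] ..
    also have "\<dots> = mult (na_eval scale mult a p) (na_eval scale mult a q)"
      using linear_comp_lin_ext[OF linear_mult_left, of "eval_word mult a" p]
      by (simp add: na_eval_def)
    finally show ?thesis .
  qed
  with lin show ?thesis by (simp add: alg_hom_def)
qed


section \<open>The free Leibniz algebra\<close>

definition leibniz_ideal :: "(bword \<Rightarrow>\<^sub>0 'k::field) set"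
  where "leibniz_ideal = alg_ideal na_scale na_mult hull
    {na_mult f (na_mult g h) - (na_mult (na_mult f g) h - na_mult (na_mult f h) g) | f g h. True}"

lemma leibniz_ideal_ideal: "alg_ideal na_scale na_mult (leibniz_ideal :: (bword \<Rightarrow>\<^sub>0 'k::field) set)"
  unfolding leibniz_ideal_def by (rule nonassoc_algebra.alg_ideal_hull[OF na_algebra])

lemma leibniz_ideal_gen:
  "na_mult f (na_mult g h) - (na_mult (na_mult f g) h - na_mult (na_mult f h) g) \<in> leibniz_ideal"
  unfolding leibniz_ideal_def by (rule hull_inc) blast

lemma leibniz_ideal_closed:
  fixes f g :: "bword \<Rightarrow>\<^sub>0 'k::field"
  shows leibniz_ideal_0: "0 \<in> (leibniz_ideal :: (bword \<Rightarrow>\<^sub>0 'k) set)"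
    and leibniz_ideal_add: "f \<in> leibniz_ideal \<Longrightarrow> g \<in> leibniz_ideal \<Longrightarrow> f + g \<in> leibniz_ideal"
    and leibniz_ideal_scale: "f \<in> leibniz_ideal \<Longrightarrow> na_scale c f \<in> leibniz_ideal"
    and leibniz_ideal_mult1: "f \<in> leibniz_ideal \<Longrightarrow> na_mult f g \<in> leibniz_ideal"
    and leibniz_ideal_mult2: "f \<in> leibniz_ideal \<Longrightarrow> na_mult g f \<in> leibniz_ideal"
proof -
  interpret na: vector_space "na_scale :: 'k \<Rightarrow> _" by (rule vector_space_na_scale)
  have I: "na.subspace leibniz_ideal"
    and m: "\<And>f g. f \<in> leibniz_ideal \<Longrightarrow> na_mult f g \<in> leibniz_ideal \<and> na_mult g f \<in> leibniz_ideal"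
    using leibniz_ideal_ideal unfolding alg_ideal_def by blast+
  show "0 \<in> (leibniz_ideal :: (bword \<Rightarrow>\<^sub>0 'k) set)" using I by (rule na.subspace_0)
  show "f \<in> leibniz_ideal \<Longrightarrow> g \<in> leibniz_ideal \<Longrightarrow> f + g \<in> leibniz_ideal"
    using I by (rule na.subspace_add)
  show "f \<in> leibniz_ideal \<Longrightarrow> na_scale c f \<in> leibniz_ideal" using I by (rule na.subspace_scale)
  show "f \<in> leibniz_ideal \<Longrightarrow> na_mult f g \<in> leibniz_ideal" using m by blast
  show "f \<in> leibniz_ideal \<Longrightarrow> na_mult g f \<in> leibniz_ideal" using m by blast
qed

lemma leibniz_ideal_neg: "f \<in> leibniz_ideal \<Longrightarrow> - f \<in> leibniz_ideal"
proof -
  interpret na: vector_space na_scale by (rule vector_space_na_scale)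
  show "f \<in> leibniz_ideal \<Longrightarrow> - f \<in> leibniz_ideal"
    using leibniz_ideal_scale[of f "-1"] by simp
qed

definition leibniz_eq :: "(bword \<Rightarrow>\<^sub>0 'k::field) \<Rightarrow> (bword \<Rightarrow>\<^sub>0 'k) \<Rightarrow> bool"
  where "leibniz_eq f g \<longleftrightarrow> f - g \<in> leibniz_ideal"

lemma equivp_leibniz_eq: "equivp (leibniz_eq :: (bword \<Rightarrow>\<^sub>0 'k::field) \<Rightarrow> _)"
proof (rule equivpI)
  have "leibniz_eq f f" for f :: "bword \<Rightarrow>\<^sub>0 'k"
    by (simp add: leibniz_eq_def leibniz_ideal_0)
  then show "reflp (leibniz_eq :: (bword \<Rightarrow>\<^sub>0 'k) \<Rightarrow> _)" by (rule reflpI)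
  have "leibniz_eq g f" if "leibniz_eq f g" for f g :: "bword \<Rightarrow>\<^sub>0 'k"
    using leibniz_ideal_neg[of "f - g"] that by (simp add: leibniz_eq_def)
  then show "symp (leibniz_eq :: (bword \<Rightarrow>\<^sub>0 'k) \<Rightarrow> _)" by (rule sympI)
  have "leibniz_eq f h" if "leibniz_eq f g" "leibniz_eq g h" for f g h :: "bword \<Rightarrow>\<^sub>0 'k"
    using leibniz_ideal_add[of "f - g" "g - h"] that by (simp add: leibniz_eq_def)
  then show "transp (leibniz_eq :: (bword \<Rightarrow>\<^sub>0 'k) \<Rightarrow> _)" by (rule transpI)
qed

quotient_type (overloaded) 'k free_leibniz = "bword \<Rightarrow>\<^sub>0 'k::field" / leibniz_eq
  by (rule equivp_leibniz_eq)

instantiation free_leibniz :: (field) ab_group_add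
begin

lift_definition zero_free_leibniz :: "'a free_leibniz" is 0 .

lift_definition plus_free_leibniz :: "'a free_leibniz \<Rightarrow> 'a free_leibniz \<Rightarrow> 'a free_leibniz" is "(+)"
  unfolding leibniz_eq_def 
  by (subst add_diff_add) (rule leibniz_ideal_add)

lift_definition uminus_free_leibniz :: "'a free_leibniz \<Rightarrow> 'a free_leibniz" is uminus
  unfolding leibniz_eq_def by (drule leibniz_ideal_neg) simp

definition "f - g = f + - (g :: 'a free_leibniz)"

instance
proof
  fix f g h :: "'a free_leibniz"
  show "f + g + h = f + (g + h)" by transfer (simp add: leibniz_eq_def leibniz_ideal_0 add.assoc)
  show "f + g = g + f" by transfer (simp add: leibniz_eq_def leibniz_ideal_0)
  show "0 + f = f" by transfer (simp add: leibniz_eq_def leibniz_ideal_0)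
  show "- f + f = 0" by transfer (simp add: leibniz_eq_def leibniz_ideal_0)
  show "f - g = f + - g" by (rule minus_free_leibniz_def)
qed

end

instantiation free_leibniz :: (field) times
begin

lift_definition times_free_leibniz :: "'a free_leibniz \<Rightarrow> 'a free_leibniz \<Rightarrow> 'a free_leibniz" is na_mult
proof -
  interpret nonassoc_algebra na_scale "na_mult :: _ \<Rightarrow> _ \<Rightarrow> (bword \<Rightarrow>\<^sub>0 'a)" by (rule na_algebra)
  fix f f' g g' :: "bword \<Rightarrow>\<^sub>0 'a"
  assume "leibniz_eq f f'" "leibniz_eq g g'"
  then have "na_mult (f - f') g + na_mult f' (g - g') \<in> leibniz_ideal"
    unfolding leibniz_eq_def
    by (intro leibniz_ideal_add leibniz_ideal_mult1 leibniz_ideal_mult2)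
  then show "leibniz_eq (na_mult f g) (na_mult f' g')"
    by (simp add: leibniz_eq_def mult_diff_left mult_diff_right)
qed

instance ..

end

lift_definition fl_scale :: "'k::field \<Rightarrow> 'k free_leibniz \<Rightarrow> 'k free_leibniz" is na_scale
proof -
  interpret na: vector_space "na_scale :: 'k \<Rightarrow> _" by (rule vector_space_na_scale)
  fix c :: 'k and f g :: "bword \<Rightarrow>\<^sub>0 'k"
  assume "leibniz_eq f g"
  then show "leibniz_eq (na_scale c f) (na_scale c g)"
    unfolding leibniz_eq_def using leibniz_ideal_scale[of "f - g" c]
    by (simp add: na.scale_right_diff_distrib)
qed

text \<open>
  The free generators. Any countably infinite index set will do; here it is all of \<open>nat\<close>, so
  there is also a generator \<open>fl_var 0\<close>.
\<close>

lift_definition fl_var :: "nat \<Rightarrow> 'k::field free_leibniz" is "\<lambda>i. Poly_Mapping.single (Var i) 1" .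

lemma abs_diff: "abs_free_leibniz (f - g) = abs_free_leibniz f - abs_free_leibniz g"
  by (simp add: minus_free_leibniz_def uminus_free_leibniz.abs_eq plus_free_leibniz.abs_eq)

lemma abs_free_leibniz_cases: obtains p where "f = abs_free_leibniz p"
  by (metis Quotient_free_leibniz Quotient_abs_rep)

lemma free_leibniz_algebra: "leibniz_algebra (fl_scale :: 'k::field \<Rightarrow> _) (*)"
proof -
  interpret na: nonassoc_algebra "na_scale :: 'k \<Rightarrow> _" na_mult by (rule na_algebra)
  note abs_eq = plus_free_leibniz.abs_eq times_free_leibniz.abs_eq fl_scale.abs_eq
  show ?thesis
  proof
    fix c d :: 'k and f g h :: "'k free_leibniz"
    obtain f' where f: "f = abs_free_leibniz f'" by (rule abs_free_leibniz_cases)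
    obtain g' where g: "g = abs_free_leibniz g'" by (rule abs_free_leibniz_cases)
    obtain h' where h: "h = abs_free_leibniz h'" by (rule abs_free_leibniz_cases)
    show "fl_scale c (f + g) = fl_scale c f + fl_scale c g"
      by (simp add: f g abs_eq na.scale_right_distrib)
    show "fl_scale (c + d) f = fl_scale c f + fl_scale d f"
      by (simp add: f abs_eq na.scale_left_distrib)
    show "fl_scale c (fl_scale d f) = fl_scale (c * d) f" by (simp add: f abs_eq)
    show "fl_scale 1 f = f" by (simp add: f abs_eq)
    show "(f + g) * h = f * h + g * h" by (simp add: f g h abs_eq na.mult_add_left)
    show "f * (g + h) = f * g + f * h" by (simp add: f g h abs_eq na.mult_add_right)
    show "fl_scale c f * g = fl_scale c (f * g)" by (simp add: f g abs_eq na.mult_scale_left)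
    show "f * fl_scale c g = fl_scale c (f * g)" by (simp add: f g abs_eq na.mult_scale_right)
    show "f * (g * h) = f * g * h - f * h * g"
      using leibniz_ideal_gen[of f' g' h']
      by (simp add: f g h abs_eq abs_diff[symmetric] free_leibniz.abs_eq_iff leibniz_eq_def)
  qed
qed


section \<open>Substitutions, identities and T-ideals\<close>

text \<open>
  The value of \<open>f\<close> under the substitution of \<open>a i\<close> for \<open>fl_var i\<close>. For a Leibniz algebra it does
  not depend on the representative of \<open>f\<close> (\<open>fl_eval_abs\<close>), and it is the unique homomorphism
  extending the substitution (\<open>fl_eval_hom\<close>, \<open>fl_eval_var\<close>, \<open>fl_hom_unique\<close>).
\<close>

definition fl_eval ::
    "('k::field \<Rightarrow> 'v::ab_group_add \<Rightarrow> 'v) \<Rightarrow> ('v \<Rightarrow> 'v \<Rightarrow> 'v) \<Rightarrow> (nat \<Rightarrow> 'v) \<Rightarrow> 'k free_leibniz \<Rightarrow> 'v"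
  where "fl_eval s m a f = na_eval s m a (rep_free_leibniz f)"

definition identities ::
    "('k::field \<Rightarrow> 'v::ab_group_add \<Rightarrow> 'v) \<Rightarrow> ('v \<Rightarrow> 'v \<Rightarrow> 'v) \<Rightarrow> 'k free_leibniz set"
  where "identities s m = {f. \<forall>a. fl_eval s m a f = 0}"

definition T_ideal :: "'k::field free_leibniz set \<Rightarrow> bool"
  where "T_ideal I \<longleftrightarrow> alg_ideal fl_scale (*) I \<and>
    (\<forall>\<phi>. alg_hom fl_scale (*) fl_scale (*) \<phi> \<longrightarrow> \<phi> ` I \<subseteq> I)"

definition T_ideal_generated :: "'k::field free_leibniz set \<Rightarrow> 'k free_leibniz set"
  where "T_ideal_generated S = T_ideal hull S"

lemma T_ideal_T_ideal_generated: "T_ideal (T_ideal_generated S)"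
  unfolding T_ideal_generated_def
proof (rule hull_in)
  interpret leibniz_algebra fl_scale "(*) :: 'a free_leibniz \<Rightarrow> _" by (rule free_leibniz_algebra)
  fix \<I> :: "'a free_leibniz set set"
  assume "Ball \<I> T_ideal"
  then show "T_ideal (\<Inter>\<I>)"
    using alg_ideal_Inter[of \<I>] unfolding T_ideal_def by blast
qed

context leibniz_algebra
begin

lemma na_eval_leibniz_ideal:
  assumes "f \<in> leibniz_ideal"
  shows "na_eval scale mult a f = 0"
proof -
  have hom: "alg_hom na_scale na_mult scale mult (na_eval scale mult a)" by (rule na_eval_hom)
  then interpret l: Vector_Spaces.linear na_scale scale "na_eval scale mult a"
    by (simp add: alg_hom_def)
  have m: "na_eval scale mult a (na_mult f g) = mult (na_eval scale mult a f) (na_eval scale mult a g)"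
    for f g using hom by (simp add: alg_hom_def)
  have z: "mult 0 x = 0" "mult x 0 = 0" for x
    using mult_diff_left[of 0 0 x] mult_diff_right[of x 0 0] by simp_all
  show ?thesis
    using assms unfolding leibniz_ideal_def
  proof (rule hull_induct)
    show "alg_ideal na_scale na_mult {f. na_eval scale mult a f = 0}"
      by (auto simp: alg_ideal_def l.vs1.subspace_def l.zero l.add l.scale m z)
  qed (auto simp: l.diff m leibniz)
qed

lemma fl_eval_abs: "fl_eval scale mult a (abs_free_leibniz f) = na_eval scale mult a f"
proof -
  interpret l: Vector_Spaces.linear na_scale scale "na_eval scale mult a"
    using na_eval_hom[of a] by (simp add: alg_hom_def)
  have "leibniz_eq (rep_free_leibniz (abs_free_leibniz f)) f"
    by (meson Quotient_free_leibniz Quotient_rep_abs equivp_leibniz_eq equivp_reflp)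
  then show ?thesis
    using na_eval_leibniz_ideal[of "rep_free_leibniz (abs_free_leibniz f) - f" a]
    by (simp add: fl_eval_def leibniz_eq_def l.diff)
qed

lemma fl_eval_hom: "alg_hom fl_scale (*) scale mult (fl_eval scale mult a)"
proof -
  interpret fl: leibniz_algebra "fl_scale :: 'k \<Rightarrow> _" "(*)" by (rule free_leibniz_algebra)
  have hom: "alg_hom na_scale na_mult scale mult (na_eval scale mult a)" by (rule na_eval_hom)
  then interpret l: Vector_Spaces.linear na_scale scale "na_eval scale mult a"
    by (simp add: alg_hom_def)
  have ex: "\<exists>f'. f = abs_free_leibniz f'" for f :: "'k free_leibniz"
    using abs_free_leibniz_cases by blast
  have "fl_eval scale mult a (f + g) = fl_eval scale mult a f + fl_eval scale mult a g" for f g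
    using ex[of f] ex[of g] by (auto simp: plus_free_leibniz.abs_eq fl_eval_abs l.add)
  moreover have "fl_eval scale mult a (fl_scale c f) = scale c (fl_eval scale mult a f)" for c f
    using ex[of f] by (auto simp: fl_scale.abs_eq fl_eval_abs l.scale)
  moreover have "fl_eval scale mult a (f * g) = mult (fl_eval scale mult a f) (fl_eval scale mult a g)"
    for f g
    using ex[of f] ex[of g] hom by (auto simp: times_free_leibniz.abs_eq fl_eval_abs alg_hom_def)
  ultimately show ?thesis
    unfolding alg_hom_def by (intro conjI allI) (unfold_locales, auto)
qed

lemma fl_eval_var: "fl_eval scale mult a (fl_var i) = a i"
  by (simp add: fl_var.abs_eq fl_eval_abs na_eval_def)

lemma fl_hom_unique:
  assumes "alg_hom fl_scale (*) scale mult \<phi>"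
  shows "\<phi> = fl_eval scale mult (\<lambda>i. \<phi> (fl_var i))"
proof
  interpret fl: leibniz_algebra "fl_scale :: 'k \<Rightarrow> _" "(*)" by (rule free_leibniz_algebra)
  have lin: "Vector_Spaces.linear fl_scale scale \<phi>"
    and m: "\<And>f g. \<phi> (f * g) = mult (\<phi> f) (\<phi> g)"
    using assms by (auto simp: alg_hom_def)
  have lin_abs: "Vector_Spaces.linear na_scale fl_scale (abs_free_leibniz :: _ \<Rightarrow> 'k free_leibniz)"
  proof -
    interpret na: vector_space "na_scale :: 'k \<Rightarrow> _" by (rule vector_space_na_scale)
    show ?thesis
      by unfold_locales (auto simp: plus_free_leibniz.abs_eq fl_scale.abs_eq)
  qed
  have w: "\<phi> (abs_free_leibniz (Poly_Mapping.single u 1)) = eval_word mult (\<lambda>i. \<phi> (fl_var i)) u" for u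
  proof (induction u)
    case (Var i)
    show ?case by (simp add: fl_var.abs_eq)
  next
    case (Br u v)
    have "abs_free_leibniz (Poly_Mapping.single (Br u v) (1 :: 'k)) =
      abs_free_leibniz (Poly_Mapping.single u 1) * abs_free_leibniz (Poly_Mapping.single v 1)"
      by (simp add: times_free_leibniz.abs_eq na_mult_single)
    with Br show ?case by (simp add: m)
  qed
  fix f :: "'k free_leibniz"
  obtain p where p: "f = abs_free_leibniz p"
    by (rule abs_free_leibniz_cases)
  have "\<phi> f = \<phi> (abs_free_leibniz (lin_ext na_scale (\<lambda>w. Poly_Mapping.single w 1) p))"
    by (simp add: p)
  also have "\<dots> = fl_eval scale mult (\<lambda>i. \<phi> (fl_var i)) f"
    unfolding linear_comp_lin_ext[OF lin_abs] linear_comp_lin_ext[OF lin] w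
    by (simp add: p fl_eval_abs na_eval_def)
  finally show "\<phi> f = fl_eval scale mult (\<lambda>i. \<phi> (fl_var i)) f" .
qed

end

definition s3 :: "'a \<Rightarrow> 'a \<Rightarrow> 'a \<Rightarrow> 'a::{ab_group_add,times}"
  where "s3 x y z = x*y*z - x*z*y - y*x*z + y*z*x + z*x*y - z*y*x"


section \<open>The algebra \<open>L\<^sub>2\<close>\<close>

text \<open>\<open>L\<^sub>2\<close> is realised on \<open>K^3\<close>, with \<open>e\<^sub>i = axis i 1\<close>.\<close>

definition L2_basis_mult :: "'k::field \<Rightarrow> 3 \<Rightarrow> 3 \<Rightarrow> 'k^3"
  where "L2_basis_mult \<alpha> i j =
    (if i = 1 \<and> j = 3 then \<alpha> *s axis 1 1
     else if i = 3 \<and> j = 2 then axis 2 1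
     else if i = 2 \<and> j = 3 then - axis 2 1
     else 0)"

definition L2_mult :: "'k::field \<Rightarrow> 'k^3 \<Rightarrow> 'k^3 \<Rightarrow> 'k^3"
  where "L2_mult \<alpha> x y = (\<Sum>i\<in>UNIV. \<Sum>j\<in>UNIV. (x $ i * y $ j) *s L2_basis_mult \<alpha> i j)"

lemma L2_mult_axis:
  fixes \<alpha> :: "'k::field"
  shows "L2_mult \<alpha> (axis i 1) (axis j 1) = L2_basis_mult \<alpha> i j"
proof -
  have *: "((if b then 1 else 0) * (if c then 1 else 0) :: 'k::field) *s v = (if c then if b then v else 0 else 0)"
    for b c and v :: "'k^3"
    by auto
  show ?thesis by (simp add: L2_mult_def axis_def *)
qed

lemma L2_mult_nth:
  "L2_mult \<alpha> x y $ 1 = \<alpha> * x $ 1 * y $ 3"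
  "L2_mult \<alpha> x y $ 2 = x $ 3 * y $ 2 - x $ 2 * y $ 3"
  "L2_mult \<alpha> x y $ 3 = 0"
  by (simp_all add: L2_mult_def L2_basis_mult_def sum_3 axis_def)

lemma L2_leibniz: "leibniz_algebra (*s) (L2_mult \<alpha>)"
  by unfold_locales (simp_all add: vec_eq_iff forall_3 L2_mult_nth algebra_simps)

end

theory Submission
  imports Defs "HOL-Library.Multiset" "HOL-Computational_Algebra.Polynomial"
begin

text \<open>
  Modulo the T-ideal \<open>T\<close> of the two polynomials every element is a combination of letters and of
  left-normed words \<open>x\<^sub>i x\<^sub>j x\<^sub>k \<dots>\<close> in which the letters after the first two commute. Substituting a
  product into \<open>s\<^sub>3\<close> gives \<open>wxyz - wyxz - zxyw + zyxw \<in> T\<close>; with \<open>s\<^sub>3\<close> itself this forces a word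
  of given content with first letters \<open>x\<^sub>i x\<^sub>j\<close> to be congruent to \<open>R\<^sub>i + C\<^sub>j\<close>. Hence a combination of
  words lies in \<open>T\<close> as soon as, for each content, its matrix of coefficients has zero row and column
  sums. In \<open>L\<^sub>2\<close> the coordinate at \<open>e\<^sub>1\<close> reads off the row sums and the coordinate at \<open>e\<^sub>2\<close> the
  differences of column and row sums, as coefficients of distinct monomials in the coordinates at
  \<open>e\<^sub>3\<close>; over an infinite field these vanish for every identity.
\<close>

section \<open>Linear combinations\<close>

text \<open>Terms with equal \<open>g x\<close> share the vector \<open>F (g x)\<close>, so only the
  fibre sums of \<open>c\<close> matter. Row and column labels of words later play the role of
  \<open>g\<close>.\<close>

lemma sum_fibres_eq_0:
  fixes c :: "'a \<Rightarrow> 'k::field" and s :: "'k \<Rightarrow> 'v::ab_group_add \<Rightarrow> 'v"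
  assumes "vector_space s" "finite S" and fib: "\<And>y. (\<Sum>x\<in>{x\<in>S. g x = y}. c x) = 0"
  shows "(\<Sum>x\<in>S. s (c x) (F (g x))) = 0"
proof -
  interpret vector_space s by fact
  have "(\<Sum>x\<in>S. s (c x) (F (g x))) = (\<Sum>y\<in>g ` S. \<Sum>x\<in>{x\<in>S. g x = y}. s (c x) (F (g x)))"
    by (rule sum.image_gen[OF \<open>finite S\<close>])
  also have "\<dots> = (\<Sum>y\<in>g ` S. s (\<Sum>x\<in>{x\<in>S. g x = y}. c x) (F y))"
    by (intro sum.cong) (auto simp: scale_sum_left)
  finally show ?thesis by (simp add: fib)
qed

text \<open>Coefficients are attached to indices rather than to vectors, so that a combination of
  values of words can be lifted to the words themselves.\<close>

lemma (in vector_space) span_range_explicit: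
  assumes "v \<in> span (range g)"
  shows "\<exists>I c. finite I \<and> v = (\<Sum>i\<in>I. scale (c i) (g i))"
proof -
  obtain t r where t: "finite t" "t \<subseteq> range g" and v: "v = (\<Sum>x\<in>t. scale (r x) x)"
    using assms unfolding span_explicit by blast
  obtain I where I: "inj_on g I" "t = g ` I"
    using t(2) unfolding subset_image_inj by blast
  have "finite I" using t(1) I by (simp add: finite_image_iff)
  moreover have "v = (\<Sum>i\<in>I. scale (r (g i)) (g i))"
    unfolding v I(2) sum.reindex[OF I(1)] by simp
  ultimately show ?thesis
    by (intro exI[of _ I] exI[of _ "\<lambda>i. r (g i)"] conjI)
qed

text \<open>A linear retraction \<open>g\<close> onto \<open>V\<close> yields the map
  \<open>x - g x\<close> with kernel \<open>V\<close>; its image models the quotient by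
  \<open>V\<close> inside the same space.\<close>

lemma (in vector_space) subspace_projection:
  assumes "subspace V"
  shows "\<exists>\<pi>. Vector_Spaces.linear scale scale \<pi> \<and> (\<forall>x. \<pi> x = 0 \<longleftrightarrow> x \<in> V) \<and> (\<forall>x. x - \<pi> x \<in> V)"
proof -
  interpret vector_space_pair scale scale ..
  obtain g where g: "range g \<subseteq> V" "Vector_Spaces.linear scale scale g" "\<forall>v\<in>V. g v = v"
    using linear_exists_left_inverse_on[OF linear_id assms inj_on_id] by auto
  have "Vector_Spaces.linear scale scale (\<lambda>x. x - g x)"
    using linear_compose_sub[OF linear_id g(2)] by simp
  moreover have "x - g x = 0 \<longleftrightarrow> x \<in> V" for x
    using g(1) bspec[OF g(3), of x] by auto
  moreover have "x - (x - g x) \<in> V" for x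
    using g(1) by auto
  ultimately show ?thesis by blast
qed

section \<open>Monomial functions over an infinite field\<close>

abbreviation monomial_fun :: "nat multiset \<Rightarrow> (nat \<Rightarrow> 'k::field) \<Rightarrow> 'k"
  where "monomial_fun N t \<equiv> prod_mset (image_mset t N)"

lemma prod_mset_fun_upd_one:
  "prod_mset (image_mset ((\<lambda>_. 1)(k := s)) N) = (s::'k::field) ^ count N k"
  by (induction N) auto

text \<open>Setting all variables but \<open>k\<close> to 1 leaves two different powers of one
  variable; their difference is a nonzero polynomial and has only finitely many roots.\<close>

lemma monomial_fun_distinct:
  assumes inf: "infinite (UNIV :: 'k::field set)" and "M \<noteq> N"
  shows "\<exists>t :: nat \<Rightarrow> 'k. monomial_fun M t \<noteq> monomial_fun N t"
proof -
  obtain k where k: "count M k \<noteq> count N k"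
    using \<open>M \<noteq> N\<close> by (auto simp: multiset_eq_iff)
  define p :: "'k poly" where "p = Polynomial.monom 1 (count M k) - Polynomial.monom 1 (count N k)"
  have "poly.coeff p (count M k) = 1" using k by (simp add: p_def)
  then have "p \<noteq> 0" by auto
  then have "finite {s. poly p s = 0}" by (rule poly_roots_finite)
  then have "{s. poly p s = 0} \<noteq> UNIV"
    using inf by auto
  then obtain s where "poly p s \<noteq> 0" by auto
  then show ?thesis
    by (intro exI[of _ "(\<lambda>_. 1)(k := s)"])
      (simp add: p_def poly_monom prod_mset_fun_upd_one del: fun_upd_apply)
qed

text \<open>Dedekind's argument: monomial functions are pairwise distinct characters of the monoid of points.\<close>

lemma monomial_fun_independent:
  assumes inf: "infinite (UNIV :: 'k::field set)" and "finite A"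
    and "\<And>t :: nat \<Rightarrow> 'k. (\<Sum>N\<in>A. c N * monomial_fun N t) = 0"
  shows "\<forall>N\<in>A. c N = 0"
  using assms(2,3)
proof (induction A arbitrary: c rule: finite_induct)
  case (insert M A)
  \<comment> \<open>The relation at \<open>t\<close> times \<open>monomial_fun M s\<close>, minus
    the relation at the pointwise product of \<open>s\<close> and \<open>t\<close>, has no term at
    \<open>M\<close>.\<close>
  have *: "\<forall>N\<in>A. c N * (monomial_fun M s - monomial_fun N s) = 0" for s
  proof (rule insert.IH)
    fix t
    have "(\<Sum>N\<in>A. c N * (monomial_fun M s - monomial_fun N s) * monomial_fun N t)
      = (\<Sum>N\<in>insert M A. c N * (monomial_fun M s - monomial_fun N s) * monomial_fun N t)"
      using insert.hyps by simp
    also have "\<dots> = (\<Sum>N\<in>insert M A. monomial_fun M s * (c N * monomial_fun N t)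
        - c N * monomial_fun N (\<lambda>i. s i * t i))"
      by (rule sum.cong) (simp_all add: prod_mset.distrib algebra_simps)
    also have "\<dots> = monomial_fun M s * (\<Sum>N\<in>insert M A. c N * monomial_fun N t)
        - (\<Sum>N\<in>insert M A. c N * monomial_fun N (\<lambda>i. s i * t i))"
      by (simp only: sum_subtractf sum_distrib_left)
    also have "\<dots> = 0" unfolding insert.prems by simp
    finally show "(\<Sum>N\<in>A. c N * (monomial_fun M s - monomial_fun N s) * monomial_fun N t) = 0" .
  qed
  have A: "c N = 0" if "N \<in> A" for N
  proof -
    have "M \<noteq> N" using that insert.hyps by auto
    then obtain s :: "nat \<Rightarrow> 'k" where "monomial_fun M s \<noteq> monomial_fun N s"
      using monomial_fun_distinct[OF inf] by blast
    with * that show ?thesis by force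
  qed
  moreover have "c M = 0"
    using insert.prems[of "\<lambda>_. 1"] insert.hyps A by simp
  ultimately show ?case by auto
qed simp

text \<open>Several \<open>x\<close> may carry the same monomial; independence applies once their
  coefficients are collected.\<close>

lemma monomial_fun_fibre_sum:
  fixes d :: "'a \<Rightarrow> 'k::field"
  assumes inf: "infinite (UNIV :: 'k set)" and "finite S"
    and zero: "\<And>t. (\<Sum>x\<in>S. d x * monomial_fun (h x) t) = 0"
  shows "(\<Sum>x\<in>{x\<in>S. h x = N}. d x) = 0"
proof -
  define c where "c N = (\<Sum>x\<in>{x\<in>S. h x = N}. d x)" for N
  have "(\<Sum>N\<in>h ` S. c N * monomial_fun N t) = (\<Sum>x\<in>S. d x * monomial_fun (h x) t)" for t
  proof -
    have "(\<Sum>x\<in>S. d x * monomial_fun (h x) t)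
      = (\<Sum>N\<in>h ` S. \<Sum>x\<in>{x\<in>S. h x = N}. d x * monomial_fun (h x) t)"
      by (rule sum.image_gen[OF \<open>finite S\<close>])
    also have "\<dots> = (\<Sum>N\<in>h ` S. c N * monomial_fun N t)"
      by (intro sum.cong) (auto simp: c_def sum_distrib_right)
    finally show ?thesis by simp
  qed
  then have "\<forall>N\<in>h ` S. c N = 0"
    using monomial_fun_independent[OF inf, of "h ` S" c] zero \<open>finite S\<close> by simp
  moreover have "c N = 0" if "N \<notin> h ` S"
    using that by (auto simp: c_def intro!: sum.neutral)
  ultimately show ?thesis unfolding c_def by blast
qed

section \<open>Left-normed words\<close>

text \<open>The first two letters are separate arguments because only the later ones commute. The
  product is a parameter: the same word is read in the free algebra, in its quotient and in
  L_2.\<close>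

definition lword :: "('v \<Rightarrow> 'v \<Rightarrow> 'v) \<Rightarrow> (nat \<Rightarrow> 'v) \<Rightarrow> nat \<Rightarrow> nat \<Rightarrow> nat list \<Rightarrow> 'v"
  where "lword m a i j ks = fold (\<lambda>k u. m u (a k)) ks (m (a i) (a j))"

lemma lword_Nil: "lword m a i j [] = m (a i) (a j)"
  and lword_snoc: "lword m a i j (ks @ [k]) = m (lword m a i j ks) (a k)"
  by (simp_all add: lword_def)

lemma lword_hom:
  assumes "alg_hom s1 m1 s2 m2 \<phi>"
  shows "\<phi> (lword m1 a i j ks) = lword m2 (\<lambda>k. \<phi> (a k)) i j ks"
  using assms by (induction ks rule: rev_induct) (auto simp: lword_Nil lword_snoc alg_hom_def)

lemma lword_is_product: "\<exists>x y. lword m a i j ks = m x y"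
  by (cases ks rule: rev_cases) (auto simp: lword_Nil lword_snoc)

lemma (in nonassoc_algebra) mult_zero: "mult 0 x = 0" "mult x 0 = 0"
  using mult_diff_left[of 0 0 x] mult_diff_right[of x 0 0] by simp_all

text \<open>By the Leibniz identity the six terms of \<open>s3 x y z\<close> pair up into x(yz) +
  y(zx) + z(xy), which gives \<open>cyclic\<close>.\<close>

locale s3_metabelian = leibniz_algebra scale mult
  for scale :: "'k::field \<Rightarrow> 'v::ab_group_add \<Rightarrow> 'v" and mult :: "'v \<Rightarrow> 'v \<Rightarrow> 'v" +
  assumes metabelian: "mult (mult x y) (mult z w) = 0"
    and cyclic: "mult x (mult y z) + mult y (mult z x) + mult z (mult x y) = 0"
begin

text \<open>The Leibniz identity writes the vanishing product (xy)(zw) as the difference of the two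
  sides.\<close>

lemma right_commute: "mult (mult (mult x y) z) w = mult (mult (mult x y) w) z"
  using leibniz[of "mult x y" z w] metabelian[of x y z w] by simp

text \<open>Substituting the product \<open>xy\<close> for one variable of \<open>s\<^sub>3\<close>.\<close>

lemma exchange:
  "mult (mult (mult w x) y) z - mult (mult (mult w y) x) z
    - mult (mult (mult z x) y) w + mult (mult (mult z y) x) w = 0"
  using cyclic[of "mult x y" z w]
  by (simp add: metabelian leibniz[of z w] leibniz[of w _ z])
    (simp add: leibniz mult_diff_left algebra_simps)

text \<open>The accumulator of the fold is always a product, which is what
  \<open>right_commute\<close> needs to swap letters of the tail.\<close>

lemma word_mset_cong:
  assumes "mset ks = mset ks'"
  shows "lword mult a i j ks = lword mult a i j ks'"
  unfolding lword_def
  by (rule fold_permuted_eq[where P = "\<lambda>u. \<exists>x y. u = mult x y"])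
    (use assms right_commute in auto)

lemma fold_mult_add:
  "fold (\<lambda>k u. mult u (a k)) ks (u + v) =
    fold (\<lambda>k u. mult u (a k)) ks u + fold (\<lambda>k u. mult u (a k)) ks v"
  by (induction ks arbitrary: u v) (auto simp: mult_add_left)

lemma fold_mult_diff:
  "fold (\<lambda>k u. mult u (a k)) ks (u - v) =
    fold (\<lambda>k u. mult u (a k)) ks u - fold (\<lambda>k u. mult u (a k)) ks v"
  by (induction ks arbitrary: u v) (auto simp: mult_diff_left)

lemma fold_mult_zero: "fold (\<lambda>k u. mult u (a k)) ks 0 = 0"
  by (induction ks) (auto simp: mult_zero)

text \<open>Right multiplication by the letters of \<open>ks\<close> is linear, so it carries
  \<open>exchange\<close> over to words with any tail.\<close>

lemma word_exchange:
  "lword mult a w x (y # z # ks) - lword mult a w y (x # z # ks)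
    - lword mult a z x (y # w # ks) + lword mult a z y (x # w # ks) = 0"
  using arg_cong[OF exchange[of "a w" "a x" "a y" "a z"], of "fold (\<lambda>k u. mult u (a k)) ks"]
  by (simp add: lword_def fold_mult_add fold_mult_diff fold_mult_zero)

lemma word_cyclic:
  "lword mult a x y (z # ks) - lword mult a x z (y # ks) - lword mult a y x (z # ks)
    + lword mult a y z (x # ks) + lword mult a z x (y # ks) - lword mult a z y (x # ks) = 0"
proof -
  have "mult (mult (a x) (a y)) (a z) - mult (mult (a x) (a z)) (a y)
    - mult (mult (a y) (a x)) (a z) + mult (mult (a y) (a z)) (a x)
    + mult (mult (a z) (a x)) (a y) - mult (mult (a z) (a y)) (a x) = 0"
    using cyclic[of "a x" "a y" "a z"] by (simp add: leibniz algebra_simps)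
  from arg_cong[OF this, of "fold (\<lambda>k u. mult u (a k)) ks"] show ?thesis
    by (simp add: lword_def fold_mult_add fold_mult_diff fold_mult_zero)
qed

text \<open>
  \<open>R\<close> and \<open>C\<close> are read off from a row and a column: those of a letter occurring twice if there is one;
  otherwise \<open>P m m\<close> is not available and two further letters are needed.
\<close>

lemma word_split_fixed_content:
  "\<exists>R C. \<forall>i j ks. mset (i # j # ks) = M \<longrightarrow> lword mult a i j ks = R i + C j"
proof -
  \<comment> \<open>The tail is put in sorted order, so \<open>P\<close> is the matrix of all words
    of content \<open>M\<close>, indexed by their first two letters.\<close>
  define P where "P i j = lword mult a i j (sorted_list_of_multiset (M - {#i, j#}))" for i j
  have P: "lword mult a i j ks = P i j" if "mset (i # j # ks) = M" for i j ks
    unfolding P_def by (rule word_mset_cong) (use that in auto)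
  have quad: "P w x = P w y + P z x - P z y" if sub: "{#w, x, y, z#} \<subseteq># M" for w x y z
  proof -
    obtain N where "M = {#w, x, y, z#} + N"
      using sub unfolding mset_subset_eq_exists_conv by blast
    moreover obtain ks where "mset ks = N" using ex_mset by blast
    ultimately have M: "M = {#w, x, y, z#} + mset ks" by simp
    have "P w x = lword mult a w x (y # z # ks)" "P w y = lword mult a w y (x # z # ks)"
      "P z x = lword mult a z x (y # w # ks)" "P z y = lword mult a z y (x # w # ks)"
      by (rule P[symmetric], simp add: M add_mset_commute)+
    with word_exchange[of a w x y z ks] show ?thesis by (simp add: algebra_simps)
  qed
  have hexa: "P x y = P x z + P y x - P y z - P z x + P z y" if sub: "{#x, y, z#} \<subseteq># M" for x y z
  proof -
    obtain N where "M = {#x, y, z#} + N"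
      using sub unfolding mset_subset_eq_exists_conv by blast
    moreover obtain ks where "mset ks = N" using ex_mset by blast
    ultimately have M: "M = {#x, y, z#} + mset ks" by simp
    have "P x y = lword mult a x y (z # ks)" "P x z = lword mult a x z (y # ks)"
      "P y x = lword mult a y x (z # ks)" "P y z = lword mult a y z (x # ks)"
      "P z x = lword mult a z x (y # ks)" "P z y = lword mult a z y (x # ks)"
      by (rule P[symmetric], simp add: M add_mset_commute)+
    with word_cyclic[of a x y z ks] show ?thesis by (simp add: algebra_simps)
  qed
  have sub: "N \<subseteq># M" if "\<And>k. count N k \<le> count M k" for N
    using that by (simp add: subseteq_mset_def)
  have "\<exists>R C. \<forall>i j. {#i, j#} \<subseteq># M \<longrightarrow> P i j = R i + C j"
  proof (cases "\<exists>m. count M m \<ge> 2")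
    case True
    then obtain m where m: "count M m \<ge> 2" by blast
    \<comment> \<open>This is \<open>quad\<close> with \<open>m\<close> in both of its last places,
      for which the second copy of \<open>m\<close> makes room.\<close>
    have "P i j = (P i m - P m m) + P m j" if ij: "{#i, j#} \<subseteq># M" for i j
    proof (cases "i = m \<or> j = m")
      case False
      have "{#i, j, m, m#} \<subseteq># M"
      proof (rule sub)
        fix k
        show "count {#i, j, m, m#} k \<le> count M k"
          using False m mset_subset_eq_count[OF ij, of k] by (cases "k = m") auto
      qed
      from quad[OF this] show ?thesis by simp
    qed auto
    then show ?thesis by (intro exI[of _ "\<lambda>i. P i m - P m m"] exI[of _ "P m"]) auto
  next
    case False
    then have le1: "count M k \<le> 1" for k by (metis not_less_eq_eq numeral_2_eq_2 One_nat_def)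
    have in1: "count M k = 1" if "k \<in># M" for k
      using le1[of k] that by (simp add: count_greater_zero_iff[symmetric] del: count_greater_zero_iff)
    have ij: "i \<in># M \<and> j \<in># M \<and> i \<noteq> j" if "{#i, j#} \<subseteq># M" for i j
      using that le1[of i] mset_subset_eq_count[OF that, of i] mset_subset_eqD[OF that] by auto
    show ?thesis
    proof (cases "\<exists>m p b. m \<in># M \<and> p \<in># M \<and> b \<in># M \<and> m \<noteq> p \<and> m \<noteq> b \<and> p \<noteq> b")
      case True
      then obtain m p b where mpb: "m \<in># M" "p \<in># M" "b \<in># M" "m \<noteq> p" "m \<noteq> b" "p \<noteq> b" by blast
      have quad': "P w x = P w y + P z x - P z y" if "distinct [w, x, y, z]" "set [w, x, y, z] \<subseteq> set_mset M"
        for w x y z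
        by (rule quad, rule sub) (use that in \<open>auto simp: in1\<close>)
      have hexa': "P m p = P m b + P p m - P p b - P b m + P b p"
        by (rule hexa, rule sub) (use mpb in \<open>auto simp: in1\<close>)
      \<comment> \<open>Normalised by \<open>C m = 0\<close>: column \<open>m\<close> gives
        \<open>R\<close> away from \<open>m\<close>, row \<open>p\<close> gives \<open>C\<close>
        away from \<open>m\<close> and \<open>p\<close>, entry \<open>(b, p)\<close> gives
        \<open>C p\<close>, and entry \<open>(m, b)\<close> gives \<open>R m\<close>.\<close>
      define R where "R i = (if i = m then P m b - P p b + P p m else P i m)" for i
      define C where "C j = (if j = m then 0 else if j = p then P b p - P b m else P p j - P p m)" for j
      have "P i j = R i + C j" if "{#i, j#} \<subseteq># M" for i j
      proof -
        note ij[OF that]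
        then consider "j = m" "i \<noteq> m" | "i = p" "j \<noteq> m" "j \<noteq> p" | "i = m" "j = p"
          | "i = b" "j = p" | "i \<notin> {m, p, b}" "j = p"
          | "i = m" "j = b" | "i = m" "j \<notin> {m, p, b}" | "i \<notin> {m, p}" "j \<notin> {m, p}" "i \<noteq> j"
          by auto
        then show ?thesis
        proof cases
          \<comment> \<open>Here s_3 itself enters: three letters occurring once each leave no room
            for \<open>quad\<close>.\<close>
          case 3 then show ?thesis using mpb hexa' by (simp add: R_def C_def)
        next
          case 5
          then show ?thesis using mpb \<open>i \<in># M \<and> j \<in># M \<and> i \<noteq> j\<close> quad'[of i p m b]
            by (simp add: R_def C_def)
        next
          case 7
          then show ?thesis using mpb \<open>i \<in># M \<and> j \<in># M \<and> i \<noteq> j\<close> quad'[of m j b p]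
            by (simp add: R_def C_def)
        next
          case 8
          then show ?thesis using mpb \<open>i \<in># M \<and> j \<in># M \<and> i \<noteq> j\<close> quad'[of i j m p]
            by (simp add: R_def C_def)
        qed (use mpb in \<open>auto simp: R_def C_def\<close>)
      qed
      then show ?thesis by blast
    next
      case no_triple: False
      \<comment> \<open>At most two letters occur, each once, so \<open>j\<close> is determined by
        \<open>i\<close> and the word depends on \<open>i\<close> alone.\<close>
      have "P i j = P i (THE k. k \<in># M - {#i#}) + 0" if "{#i, j#} \<subseteq># M" for i j
      proof -
        note ij[OF that]
        have "k = j" if "k \<in># M - {#i#}" for k
        proof -
          have "k \<in># M" using that by (rule in_diffD)
          moreover have "k \<noteq> i"
            using that in1[of i] \<open>i \<in># M \<and> j \<in># M \<and> i \<noteq> j\<close> by (auto simp: in_diff_count)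
          ultimately show ?thesis using no_triple \<open>i \<in># M \<and> j \<in># M \<and> i \<noteq> j\<close> by metis
        qed
        moreover have "j \<in># M - {#i#}"
          using \<open>i \<in># M \<and> j \<in># M \<and> i \<noteq> j\<close> by (simp add: in_diff_count)
        ultimately have "(THE k. k \<in># M - {#i#}) = j" by (intro the_equality)
        then show ?thesis by simp
      qed
      then show ?thesis by (intro exI[of _ "\<lambda>i. P i (THE k. k \<in># M - {#i#})"] exI[of _ "\<lambda>_. 0"]) blast
    qed
  qed
  then obtain R C where RC: "\<And>i j. {#i, j#} \<subseteq># M \<Longrightarrow> P i j = R i + C j" by blast
  have "lword mult a i j ks = R i + C j" if "mset (i # j # ks) = M" for i j ks
    using P[OF that] RC[of i j] that by auto
  then show ?thesis by blast
qed

text \<open>A label consists of one letter and the content of all the others, so it fixes both the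
  total content and the row or column. These labels match the monomials visible in L_2.\<close>

lemma word_split:
  "\<exists>R C. \<forall>i j ks. lword mult a i j ks = R (i, mset (j # ks)) + C (j, mset (i # ks))"
proof -
  obtain R C where RC: "\<And>M i j ks. mset (i # j # ks) = M \<Longrightarrow> lword mult a i j ks = R M i + C M j"
    using word_split_fixed_content[of _ a] by metis
  show ?thesis
    by (rule exI[of _ "\<lambda>(i, N). R (add_mset i N) i"], rule exI[of _ "\<lambda>(j, N). C (add_mset j N) j"])
      (auto intro!: RC simp: add_mset_commute)
qed

section \<open>Spanning by letters and left-normed words\<close>

lemma mult_words: "mult (lword mult a i j ks) (lword mult a i' j' ks') = 0"
  by (metis lword_is_product metabelian)

text \<open>For a word w, a_i(w a_l) = (a_i w)a_l - (a_i a_l)w, and the last term is a product of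
  two products, hence 0. Induction on the tail follows.\<close>

lemma mult_letter_word:
  "mult (a i) (lword mult a j k ks) \<in> span (range (\<lambda>(i, j, ks). lword mult a i j ks))"
    (is "_ \<in> ?D")
proof -
  have word: "lword mult a i j ks \<in> ?D" for i j ks
    by (rule span_base) (rule range_eqI[of _ _ "(i, j, ks)"], simp)
  have right: "mult v (a l) \<in> ?D" if "v \<in> ?D" for v l
    using that
  proof (induction rule: span_induct_alt)
    case base
    show ?case by (simp add: mult_zero span_zero)
  next
    case (step c x y)
    then obtain i j ks where "x = lword mult a i j ks" by auto
    then have "mult x (a l) \<in> ?D"
      using word[of i j "ks @ [l]"] by (simp add: lword_snoc)
    with step show ?case by (simp add: mult_add_left mult_scale_left span_add span_scale)
  qed
  show ?thesis
  proof (induction ks rule: rev_induct)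
    case Nil
    show ?case
      using span_diff[OF word[of i j "[k]"] word[of i k "[j]"]]
      by (simp add: lword_def leibniz)
  next
    case (snoc l ks)
    have "mult (mult (a i) (a l)) (lword mult a j k ks) = 0"
      by (metis lword_is_product metabelian)
    with right[OF snoc.IH] show ?case by (simp add: lword_snoc leibniz)
  qed
qed

lemma mult_in_span_words:
  fixes a :: "nat \<Rightarrow> 'v"
  defines "G \<equiv> range a \<union> range (\<lambda>(i, j, ks). lword mult a i j ks)"
  assumes "x \<in> span G" "y \<in> span G"
  shows "mult x y \<in> span G"
proof -
  have words: "lword mult a i j ks \<in> span G" for i j ks
    unfolding G_def by (rule span_base) (auto intro: rev_image_eqI[of "(i, j, ks)"])
  have gen: "mult u v \<in> span G" if "u \<in> G" "v \<in> G" for u v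
  proof -
    have D: "span (range (\<lambda>(i, j, ks). lword mult a i j ks)) \<subseteq> span G"
      unfolding G_def by (intro span_mono) auto
    consider i j where "u = a i" "v = a j" | i j k ks where "u = a i" "v = lword mult a j k ks"
      | i j ks k where "u = lword mult a i j ks" "v = a k"
      | i j ks i' j' ks' where "u = lword mult a i j ks" "v = lword mult a i' j' ks'"
      using \<open>u \<in> G\<close> \<open>v \<in> G\<close> unfolding G_def by auto
    then show ?thesis
    proof cases
      case 1 then show ?thesis using words[of i j "[]"] by (simp add: lword_Nil)
    next
      case 2 then show ?thesis using mult_letter_word D by blast
    next
      case 3 then show ?thesis using words[of i j "ks @ [k]"] by (simp add: lword_snoc)
    next
      case 4 then show ?thesis by (simp add: mult_words span_zero)
    qed
  qed
  have left: "mult u y \<in> span G" if "u \<in> G" for u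
    using assms(3)
    by (induction rule: span_induct_alt)
      (auto simp: mult_zero span_zero mult_add_right mult_scale_right
        intro!: span_add span_scale gen that)
  show ?thesis
    using assms(2)
    by (induction rule: span_induct_alt)
      (auto simp: mult_zero span_zero mult_add_left mult_scale_left
        intro!: span_add span_scale left)
qed

lemma fl_eval_in_span_words:
  "fl_eval scale mult a f \<in> span (range a \<union> range (\<lambda>(i, j, ks). lword mult a i j ks))"
proof -
  have "eval_word mult a w \<in> span (range a \<union> range (\<lambda>(i, j, ks). lword mult a i j ks))" for w
    by (induction w) (auto intro: mult_in_span_words span_base)
  then show ?thesis
    unfolding fl_eval_def na_eval_def lin_ext_def by (intro span_sum span_scale)
qed

end

section \<open>Identities of Leibniz algebras\<close>

lemma alg_homD:
  assumes "alg_hom s1 m1 s2 m2 \<phi>"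
  shows "Vector_Spaces.linear s1 s2 \<phi>" "\<phi> (m1 f g) = m2 (\<phi> f) (\<phi> g)"
    "\<phi> (f + g) = \<phi> f + \<phi> g" "\<phi> (f - g) = \<phi> f - \<phi> g" "\<phi> (s1 c f) = s2 c (\<phi> f)" "\<phi> 0 = 0"
    "\<phi> (sum h A) = (\<Sum>x\<in>A. \<phi> (h x))"
proof -
  show lin: "Vector_Spaces.linear s1 s2 \<phi>" and "\<phi> (m1 f g) = m2 (\<phi> f) (\<phi> g)"
    using assms by (auto simp: alg_hom_def)
  interpret l: Vector_Spaces.linear s1 s2 \<phi> by (rule lin)
  show "\<phi> (f + g) = \<phi> f + \<phi> g" "\<phi> (f - g) = \<phi> f - \<phi> g" "\<phi> (s1 c f) = s2 c (\<phi> f)" "\<phi> 0 = 0"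
    "\<phi> (sum h A) = (\<Sum>x\<in>A. \<phi> (h x))"
    by (simp_all add: l.add l.diff l.scale l.zero l.sum)
qed

lemma alg_hom_compose:
  assumes "alg_hom s m s' m' \<phi>" "alg_hom s' m' s'' m'' \<psi>"
  shows "alg_hom s m s'' m'' (\<lambda>x. \<psi> (\<phi> x))"
  using Vector_Spaces.linear_compose[OF alg_homD(1)[OF assms(1)] alg_homD(1)[OF assms(2)]] alg_homD(2)[OF assms(1)]
    alg_homD(2)[OF assms(2)]
  by (simp add: alg_hom_def comp_def)

text \<open>An endomorphism followed by a substitution is again a substitution, by
  \<open>fl_hom_unique\<close>, and so vanishes on every identity.\<close>

lemma (in leibniz_algebra) T_ideal_identities: "T_ideal (identities scale mult)"
proof -
  interpret fl: leibniz_algebra "fl_scale :: 'k \<Rightarrow> _" "(*)" by (rule free_leibniz_algebra)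
  note hom = alg_homD[OF fl_eval_hom]
  have "alg_ideal fl_scale (*) (identities scale mult)"
    by (auto simp: alg_ideal_def identities_def fl.subspace_def hom mult_zero)
  moreover have "fl_eval scale mult a (\<phi> f) = 0"
    if "alg_hom fl_scale (*) fl_scale (*) \<phi>" and f: "f \<in> identities scale mult" for \<phi> a f
  proof -
    have "alg_hom fl_scale (*) scale mult (\<lambda>f. fl_eval scale mult a (\<phi> f))"
      using that(1) fl_eval_hom by (rule alg_hom_compose)
    then show ?thesis
      using fun_cong[OF fl_hom_unique, of "\<lambda>f. fl_eval scale mult a (\<phi> f)" f] f
      by (simp add: identities_def)
  qed
  ultimately show ?thesis by (auto simp: T_ideal_def identities_def)
qed

lemma T_ideal_substitute:
  fixes I :: "'k::field free_leibniz set"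
  assumes "T_ideal I" "f \<in> I"
  shows "fl_eval fl_scale (*) a f \<in> I"
  using assms leibniz_algebra.fl_eval_hom[OF free_leibniz_algebra, of a]
  by (auto simp: T_ideal_def)

text \<open>
  A linear projection with kernel \<open>I\<close> carries the multiplication of the quotient by \<open>I\<close> over to
  a product on the free algebra itself.
\<close>

lemma T_ideal_projection:
  fixes I :: "'k::field free_leibniz set"
  assumes "T_ideal I"
  obtains \<pi> m where "\<And>f. \<pi> f = 0 \<longleftrightarrow> f \<in> I" "\<And>f. f - \<pi> f \<in> I" "leibniz_algebra fl_scale m"
    "alg_hom fl_scale (*) fl_scale m \<pi>" "\<And>f g. m f g = \<pi> (f * g)"
proof -
  interpret fl: leibniz_algebra "fl_scale :: 'k \<Rightarrow> _" "(*)" by (rule free_leibniz_algebra)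
  have I: "fl.subspace I" "\<And>f g. f \<in> I \<Longrightarrow> f * g \<in> I" "\<And>f g. f \<in> I \<Longrightarrow> g * f \<in> I"
    using assms by (auto simp: T_ideal_def alg_ideal_def)
  obtain \<pi> where lin: "Vector_Spaces.linear fl_scale fl_scale \<pi>"
    and ker: "\<And>f. \<pi> f = 0 \<longleftrightarrow> f \<in> I" and diff: "\<And>f. f - \<pi> f \<in> I"
    using fl.subspace_projection[OF I(1)] by blast
  interpret l: Vector_Spaces.linear fl_scale fl_scale \<pi> by (rule lin)
  have eq: "\<pi> f = \<pi> g" if "f - g \<in> I" for f g
    using that by (simp add: ker[symmetric] l.diff)
  have left: "\<pi> (\<pi> f * g) = \<pi> (f * g)" for f g
    using I(2)[OF diff[of f], of g] by (intro eq[symmetric]) (simp add: fl.mult_diff_left)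
  have right: "\<pi> (f * \<pi> g) = \<pi> (f * g)" for f g
    using I(3)[OF diff[of g], of f] by (intro eq[symmetric]) (simp add: fl.mult_diff_right)
  show ?thesis
  proof (rule that[OF ker diff])
    show "leibniz_algebra fl_scale (\<lambda>f g. \<pi> (f * g))"
      by unfold_locales
        (simp_all add: left right fl.mult_add_left fl.mult_add_right fl.mult_scale_left
          fl.mult_scale_right l.add l.scale fl.leibniz l.diff)
    show "alg_hom fl_scale (*) fl_scale (\<lambda>f g. \<pi> (f * g)) \<pi>"
      using lin by (simp add: alg_hom_def left right)
  qed (rule refl)
qed

section \<open>Evaluation in \<open>L\<^sub>2\<close>\<close>

text \<open>A word has e_3 coordinate 0, so each further letter only scales: e_1 by \<alpha> times
  the letter's e_3 coordinate, e_2 by minus that coordinate.\<close>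

lemma lword_L2:
  shows lword_L2_1: "lword (L2_mult \<alpha>) a i j ks $ 1
      = \<alpha> ^ Suc (length ks) * a i $ 1 * monomial_fun (mset (j # ks)) (\<lambda>k. a k $ 3)"
    and lword_L2_2: "lword (L2_mult \<alpha>) a i j ks $ 2
      = (- 1) ^ length ks * (a j $ 2 * monomial_fun (mset (i # ks)) (\<lambda>k. a k $ 3)
          - a i $ 2 * monomial_fun (mset (j # ks)) (\<lambda>k. a k $ 3))"
    and lword_L2_3: "lword (L2_mult \<alpha>) a i j ks $ 3 = 0"
proof -
  show 3: "lword (L2_mult \<alpha>) a i j ks $ 3 = 0" for ks
    by (cases ks rule: rev_cases) (simp_all add: lword_Nil lword_snoc L2_mult_nth)
  show "lword (L2_mult \<alpha>) a i j ks $ 1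
      = \<alpha> ^ Suc (length ks) * a i $ 1 * monomial_fun (mset (j # ks)) (\<lambda>k. a k $ 3)"
    by (induction ks rule: rev_induct) (simp_all add: lword_Nil lword_snoc L2_mult_nth)
  show "lword (L2_mult \<alpha>) a i j ks $ 2
      = (- 1) ^ length ks * (a j $ 2 * monomial_fun (mset (i # ks)) (\<lambda>k. a k $ 3)
          - a i $ 2 * monomial_fun (mset (j # ks)) (\<lambda>k. a k $ 3))"
  proof (induction ks rule: rev_induct)
    case (snoc k ks)
    show ?case
      by (simp only: lword_snoc L2_mult_nth snoc.IH 3) (simp add: algebra_simps)
  qed (simp add: lword_Nil L2_mult_nth)
qed

lemma L2_coefficients:
  fixes \<alpha> :: "'k::field" and c :: "nat \<times> nat \<times> nat list \<Rightarrow> 'k"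
  assumes inf: "infinite (UNIV :: 'k set)" and "\<alpha> \<noteq> 0" and fin: "finite I" "finite S"
    and zero: "\<And>a :: nat \<Rightarrow> 'k^3.
      (\<Sum>i\<in>I. b i *s a i) + (\<Sum>(i, j, ks)\<in>S. c (i, j, ks) *s lword (L2_mult \<alpha>) a i j ks) = 0"
  shows "\<forall>i\<in>I. b i = 0"
    and "(\<Sum>x\<in>{x\<in>S. (\<lambda>(i, j, ks). (i, mset (j # ks))) x = y}. c x) = 0"
    and "(\<Sum>x\<in>{x\<in>S. (\<lambda>(i, j, ks). (j, mset (i # ks))) x = y}. c x) = 0"
proof -
  define ltr where "ltr = (\<lambda>(i::nat, j::nat, ks::nat list). (i, mset (j # ks)))"
  define rtr where "rtr = (\<lambda>(i::nat, j::nat, ks::nat list). (j, mset (i # ks)))"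
  have comp: "(\<Sum>i\<in>I. b i * a i $ n)
      + (\<Sum>(i, j, ks)\<in>S. c (i, j, ks) * lword (L2_mult \<alpha>) a i j ks $ n) = 0" for a n
    using arg_cong[OF zero[of a], of "\<lambda>v. v $ n"] by (simp add: case_prod_unfold)
  show b: "\<forall>i\<in>I. b i = 0"
  proof
    fix l assume "l \<in> I"
    \<comment> \<open>Words vanish at e_3, so substituting e_3 for letter \<open>l\<close> and 0 for
      the others isolates \<open>b l\<close>.\<close>
    with comp[of "\<lambda>i. if i = l then axis 3 1 else 0" 3] fin(1) show "b l = 0"
      by (simp add: lword_L2 case_prod_unfold if_distrib[of "\<lambda>v. v $ _"] if_distrib[of "(*) _"] axis_def
          cong: if_cong)
  qed
  have words: "(\<Sum>(i, j, ks)\<in>S. c (i, j, ks) * lword (L2_mult \<alpha>) a i j ks $ n) = 0" for a n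
    using comp[of a n] b by simp
  have row: "(\<Sum>x\<in>{x\<in>S. ltr x = y}. c x) = 0" for y
  proof -
    obtain l N where y: "y = (l, N)" by (cases y)
    let ?d = "\<lambda>(i, j, ks). c (i, j, ks) * \<alpha> ^ Suc (length ks) * of_bool (i = l)"
    have "(\<Sum>x\<in>{x\<in>S. snd (ltr x) = N}. ?d x) = 0"
    proof (rule monomial_fun_fibre_sum[OF inf fin(2)])
      fix t :: "nat \<Rightarrow> 'k"
      \<comment> \<open>The e_1 component selects the words with first letter \<open>l\<close>; the
        e_3 coordinates stay free as variables.\<close>
      define a :: "nat \<Rightarrow> 'k^3" where "a i = of_bool (i = l) *s axis 1 1 + t i *s axis 3 1" for i
      have a: "a i $ 1 = of_bool (i = l)" "a i $ 3 = t i" for i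
        by (simp_all add: a_def axis_def)
      show "(\<Sum>x\<in>S. ?d x * monomial_fun (snd (ltr x)) t) = 0"
        using words[of a 1] by (simp add: lword_L2 a ltr_def case_prod_unfold mult_ac)
    qed
    \<comment> \<open>On this fibre \<open>size N = Suc (length ks)\<close>, so the power of
      \<alpha> is a common nonzero factor.\<close>
    also have "(\<Sum>x\<in>{x\<in>S. snd (ltr x) = N}. ?d x) = (\<Sum>x\<in>{x\<in>S. ltr x = y}. c x * \<alpha> ^ size N)"
      by (rule sum.mono_neutral_cong_right) (use fin(2) in \<open>auto simp: ltr_def y\<close>)
    finally show ?thesis
      using \<open>\<alpha> \<noteq> 0\<close> by (simp add: sum_distrib_right[symmetric])
  qed
  then show "(\<Sum>x\<in>{x\<in>S. (\<lambda>(i, j, ks). (i, mset (j # ks))) x = y}. c x) = 0"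
    unfolding ltr_def .
  have col: "(\<Sum>x\<in>{x\<in>S. rtr x = y}. c x) = 0" for y
  proof -
    obtain l N where y: "y = (l, N)" by (cases y)
    let ?d = "\<lambda>(i, j, ks). c (i, j, ks) * (- 1) ^ length ks * of_bool (j = l)"
    have "(\<Sum>x\<in>{x\<in>S. snd (rtr x) = N}. ?d x) = 0"
    proof (rule monomial_fun_fibre_sum[OF inf fin(2)])
      fix t :: "nat \<Rightarrow> 'k"
      define a :: "nat \<Rightarrow> 'k^3" where "a i = of_bool (i = l) *s axis 2 1 + t i *s axis 3 1" for i
      have a: "a i $ 2 = of_bool (i = l)" "a i $ 3 = t i" for i
        by (simp_all add: a_def axis_def)
      \<comment> \<open>The subtracted part of the e_2 coordinate depends only on the row label, so
        \<open>row\<close> kills it. Since \<open>N\<close> is the content of \<open>j # ks\<close>,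
        the exponent \<open>size N - 1\<close> is \<open>length ks\<close>.\<close>
      have "(\<Sum>x\<in>S. c x * (case ltr x of (i, N) \<Rightarrow> (- 1) ^ (size N - 1) * of_bool (i = l) * monomial_fun N t)) = 0"
        by (rule sum_fibres_eq_0[where s = "(*)"]) (use fin(2) row in \<open>auto simp: vector_space_def algebra_simps\<close>)
      then show "(\<Sum>x\<in>S. ?d x * monomial_fun (snd (rtr x)) t) = 0"
        using words[of a 2]
        by (simp add: lword_L2 a ltr_def rtr_def case_prod_unfold algebra_simps sum_subtractf)
    qed
    also have "(\<Sum>x\<in>{x\<in>S. snd (rtr x) = N}. ?d x)
        = (\<Sum>x\<in>{x\<in>S. rtr x = y}. c x * (- 1) ^ (size N - 1))"
      by (rule sum.mono_neutral_cong_right) (use fin(2) in \<open>auto simp: rtr_def y\<close>)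
    finally show ?thesis
      by (simp add: sum_distrib_right[symmetric])
  qed
  then show "(\<Sum>x\<in>{x\<in>S. (\<lambda>(i, j, ks). (j, mset (i # ks))) x = y}. c x) = 0"
    unfolding rtr_def .
qed

theorem theorem3p4:
  fixes \<alpha> :: "'k::field"
  assumes "infinite (UNIV :: 'k set)"
    and "\<alpha> \<noteq> 0"
  shows "T_ideal_generated
      {(fl_var 1 * fl_var 2) * (fl_var 3 * fl_var 4), s3 (fl_var 1) (fl_var 2) (fl_var 3)}
    = identities (*s) (L2_mult \<alpha>)"
    (is "T_ideal_generated ?gens = _")
proof
  interpret L2: leibniz_algebra "(*s)" "L2_mult \<alpha>" by (rule L2_leibniz)
  interpret fl: leibniz_algebra "fl_scale :: 'k \<Rightarrow> _" "(*)" by (rule free_leibniz_algebra)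
  define T where "T = (T_ideal_generated ?gens :: 'k free_leibniz set)"
  note L2_hom = alg_homD[OF L2.fl_eval_hom] and fl_hom = alg_homD[OF fl.fl_eval_hom]
  have "?gens \<subseteq> identities (*s) (L2_mult \<alpha>)"
    by (auto simp: identities_def s3_def L2_hom L2.fl_eval_var vec_eq_iff forall_3 L2_mult_nth algebra_simps)
  then have sound: "T \<subseteq> identities (*s) (L2_mult \<alpha>)"
    unfolding T_def T_ideal_generated_def by (rule hull_minimal) (rule L2.T_ideal_identities)
  then show "T_ideal_generated ?gens \<subseteq> identities (*s) (L2_mult \<alpha>)"
    unfolding T_def .
  have T: "T_ideal T" unfolding T_def by (rule T_ideal_T_ideal_generated)
  have "?gens \<subseteq> T" unfolding T_def T_ideal_generated_def by (rule hull_subset)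
  then have gens: "(fl_var 1 * fl_var 2) * (fl_var 3 * fl_var 4) \<in> T"
    "s3 (fl_var 1) (fl_var 2) (fl_var 3) \<in> T" by auto
  have metab: "(f * g) * (h * k) \<in> T" for f g h k
    using T_ideal_substitute[OF T gens(1), of "(\<lambda>_. 0)(1 := f, 2 := g, 3 := h, 4 := k)"]
    by (simp add: fl_hom fl.fl_eval_var)
  have s3: "s3 f g h \<in> T" for f g h
    using T_ideal_substitute[OF T gens(2), of "(\<lambda>_. 0)(1 := f, 2 := g, 3 := h)"]
    by (simp add: fl_hom fl.fl_eval_var s3_def)
  obtain \<pi> m where ker: "\<And>f. \<pi> f = 0 \<longleftrightarrow> f \<in> T" and diff: "\<And>f. f - \<pi> f \<in> T"
    and leib: "leibniz_algebra fl_scale m" and hom: "alg_hom fl_scale (*) fl_scale m \<pi>"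
    and m: "\<And>f g. m f g = \<pi> (f * g)"
    using T_ideal_projection[OF T] by metis
  note \<pi> = alg_homD[OF hom]
  interpret Q: leibniz_algebra fl_scale m by (rule leib)
  \<comment> \<open>The product \<open>m\<close> models the quotient by \<open>T\<close>. Arguments
    of \<open>m\<close> may be replaced by their images under \<pi>, which turns memberships in
    \<open>T\<close> into equations for \<open>m\<close>.\<close>
  interpret Q: s3_metabelian fl_scale m
  proof
    have "\<pi> (\<pi> f) = \<pi> f" for f
      using diff[of f] by (simp add: ker[symmetric] \<pi>(4))
    then have proj: "m (\<pi> f) g = m f g" "m f (\<pi> g) = m f g" for f g
      by (metis m \<pi>(2))+
    show "m (m f g) (m h k) = 0" for f g h k
      using metab[of f g h k] by (simp add: ker[symmetric] \<pi>(2) proj)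
    show "m f (m g h) + m g (m h f) + m h (m f g) = 0" for f g h
    proof -
      have "s3 f g h = f * (g * h) + g * (h * f) + h * (f * g)"
        by (simp add: s3_def fl.leibniz algebra_simps)
      with s3[of f g h] show ?thesis
        by (simp add: ker[symmetric] \<pi>(2,3) proj)
    qed
  qed
  have "identities (*s) (L2_mult \<alpha>) \<subseteq> T"
  proof
    fix f assume f: "f \<in> identities (*s) (L2_mult \<alpha>)"
    define x where "x = (\<lambda>i. \<pi> (fl_var i))"
    have "\<pi> f = fl_eval fl_scale m x f"
      unfolding x_def by (rule fun_cong[OF Q.fl_hom_unique[OF hom]])
    also have "\<dots> \<in> fl.span (range x \<union> range (\<lambda>(i, j, ks). lword m x i j ks))"
      by (rule Q.fl_eval_in_span_words)
    finally obtain u v where uv: "\<pi> f = u + v" "u \<in> fl.span (range x)"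
      "v \<in> fl.span (range (\<lambda>(i, j, ks). lword m x i j ks))"
      by (auto simp: fl.span_Un)
    obtain I b where I: "finite I" and u: "u = (\<Sum>i\<in>I. fl_scale (b i) (x i))"
      using fl.span_range_explicit[OF uv(2)] by blast
    obtain S c where S: "finite S"
      and v: "v = (\<Sum>w\<in>S. fl_scale (c w) (case w of (i, j, ks) \<Rightarrow> lword m x i j ks))"
      using fl.span_range_explicit[OF uv(3)] by blast
    \<comment> \<open>\<open>g\<close> lifts the normal form of \<open>\<pi> f\<close> to the free
      algebra. As \<open>f - g\<close> lies in \<open>T\<close>, it is an identity, so
      \<open>g\<close> vanishes in L_2 together with \<open>f\<close>.\<close>
    define g where "g = (\<Sum>i\<in>I. fl_scale (b i) (fl_var i))
      + (\<Sum>(i, j, ks)\<in>S. fl_scale (c (i, j, ks)) (lword (*) fl_var i j ks))"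
    have "\<pi> g = \<pi> f"
      by (simp add: g_def uv(1) u v \<pi> x_def lword_hom[OF hom] case_prod_unfold)
    then have "f - g \<in> identities (*s) (L2_mult \<alpha>)"
      using sound by (auto simp: ker[symmetric] \<pi>)
    then have "fl_eval (*s) (L2_mult \<alpha>) a g = 0" for a
      using f by (simp add: identities_def L2_hom)
    then have zero: "(\<Sum>i\<in>I. b i *s a i)
        + (\<Sum>(i, j, ks)\<in>S. c (i, j, ks) *s lword (L2_mult \<alpha>) a i j ks) = 0" for a
      by (simp add: g_def L2_hom L2.fl_eval_var lword_hom[OF L2.fl_eval_hom] case_prod_unfold)
    note coeffs = L2_coefficients[OF assms I S zero]
    obtain R C where RC: "\<And>i j ks. lword m x i j ks = R (i, mset (j # ks)) + C (j, mset (i # ks))"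
      using Q.word_split[of x] by blast
    have "u = 0" using coeffs(1) by (simp add: u)
    \<comment> \<open>Splitting each word into its row and column parts leaves two sums, each killed
      by its vanishing coefficient sums.\<close>
    moreover have "v = (\<Sum>w\<in>S. fl_scale (c w) (R ((\<lambda>(i, j, ks). (i, mset (j # ks))) w)))
        + (\<Sum>w\<in>S. fl_scale (c w) (C ((\<lambda>(i, j, ks). (j, mset (i # ks))) w)))"
      unfolding v sum.distrib[symmetric]
      by (intro sum.cong) (auto simp: RC fl.scale_right_distrib split: prod.splits)
    then have "v = 0"
      by (simp only: sum_fibres_eq_0[OF fl.vector_space_axioms S coeffs(2)]
          sum_fibres_eq_0[OF fl.vector_space_axioms S coeffs(3)]) simp
    ultimately show "f \<in> T"
      using uv(1) by (simp add: ker[symmetric])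
  qed
  then show "identities (*s) (L2_mult \<alpha>) \<subseteq> T_ideal_generated ?gens"
    unfolding T_def .
qed

end
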